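(* Let $F$ be the free group of rank $m$, let $R\subset F$, and let $f_k=|R\cap S_k|/|S_k|$ be the relative frequency of elements of $R$ in the sphere $S_k$. Assume that the function $$\mu^*(R)=\frac{2m}{2m-1}\sum_{k=0}^\infty f_k(1-s)^k ,\qquad s\in(0,1),$$ can be continued analytically to a neighbourhood of $s=0$ and is regular at $0$. Then the set $R$ is polynomially negligible.
   Context: $F$ is the free group with finite basis $X=\{x_1,\dots,x_m\}$, identified with the set of freely reduced words in $X\cup X^{-1}$; $|w|$ is the length of $w$; $S_k$ is the set of elements of length $k$, so $|S_0|=1$ and $|S_k|=2m(2m-1)^{k-1}$ for $k\ge 1$. For $s\in(0,1)$ let $\mu_s$ be the atomic probability measure on $F$ with $\mu_s(1)=s$ and $\mu_s(w)=\frac{s(1-s)^{|w|}}{2m(2m-1)^{|w|-1}}$ for $w\neq 1$. Growth on average: for a non-negative function $f:F\to\mathbb R$ put $M_f(s)=\sum_{w\in F}f(w)\mu_s(w)$, assumed finite for every $s\in(0,1)$. Fix an arbitrary continuous probability density $\eta$ on $(0,1)$. For an integer $d\ge 0$, $f$ has polynomial growth of degree at most $d$ on average (with respect to $\eta$) if $\int_0^1 s^dM_f(s)\eta(s)\,ds$ converges at $0$, i.e. $\int_0^{\varepsilon}s^dM_f(s)\eta(s)\,ds<\infty$ for some $\varepsilon\in(0,1)$; the degree of growth is the least such $d$. A set $R\subset F$ with characteristic function $\chi$ is polynomially negligible if for every positive integer $d$ the function $w\mapsto |w|^d\chi(w)$ has growth of degree at most $0$ on average. *)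

theory Defs
  imports "HOL-Analysis.Analysis" "HOL-Complex_Analysis.Complex_Analysis" "HOL-Algebra.Group"
begin

section \<open>The free group as the group of freely reduced words\<close>

text \<open>The letter \<open>(x, False)\<close> stands for the generator \<open>x\<close>, and \<open>(x, True)\<close> for its inverse.\<close>

type_synonym 'a letter = "'a \<times> bool"

definition letter_inv :: "'a letter \<Rightarrow> 'a letter" where
  "letter_inv a = (fst a, \<not> snd a)"

definition reduced :: "'a letter list \<Rightarrow> bool" where
  "reduced w \<longleftrightarrow> successively (\<lambda>a b. b \<noteq> letter_inv a) w"

definition push :: "'a letter \<Rightarrow> 'a letter list \<Rightarrow> 'a letter list" where
  "push a w = (case w of [] \<Rightarrow> [a] | b # v \<Rightarrow> if b = letter_inv a then v else a # w)"

text \<open>The product of two reduced words is the free reduction of their concatenation: the letters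
  of the left factor are pushed one by one onto the right factor.\<close>

definition free_group :: "'a set \<Rightarrow> 'a letter list monoid" where
  "free_group X = \<lparr>carrier = {w. fst ` set w \<subseteq> X \<and> reduced w},
                   monoid.mult = foldr push, one = []\<rparr>"

lemma letter_inv_simps [simp]:
  "letter_inv (letter_inv a) = a" "fst (letter_inv a) = fst a"
  "letter_inv a \<noteq> a" "a \<noteq> letter_inv a"
  by (cases a; simp add: letter_inv_def)+

lemma letter_inv_eq_iff: "a = letter_inv b \<longleftrightarrow> b = letter_inv a"
  by (metis letter_inv_simps(1))

lemma reduced_Nil [simp]: "reduced []"
  by (simp add: reduced_def)

lemma reduced_Cons: "reduced (a # w) \<longleftrightarrow> (w = [] \<or> hd w \<noteq> letter_inv a) \<and> reduced w"
  by (cases w) (auto simp: reduced_def)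

lemma reduced_push: "reduced w \<Longrightarrow> reduced (push a w)"
  by (cases w) (auto simp: push_def reduced_Cons)

lemma push_eq_Cons: "reduced (a # w) \<Longrightarrow> push a w = a # w"
  by (cases w) (auto simp: push_def reduced_Cons)

lemma push_push_inv: "reduced w \<Longrightarrow> push a (push (letter_inv a) w) = w"
  by (cases w; cases "tl w") (auto simp: push_def reduced_Cons)

lemma reduced_foldr_push: "reduced w \<Longrightarrow> reduced (foldr push u w)"
  by (induction u) (auto simp: reduced_push)

lemma set_push: "set (push a w) \<subseteq> insert a (set w)"
  by (cases w) (auto simp: push_def)

lemma set_foldr_push: "set (foldr push u w) \<subseteq> set u \<union> set w"
  by (induction u) (use set_push in fastforce)+

lemma foldr_push_push:
  assumes "reduced w"
  shows "foldr push (push a v) w = push a (foldr push v w)"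
proof (cases v)
  case (Cons b v')
  show ?thesis
  proof (cases "b = letter_inv a")
    case True
    then show ?thesis
      using push_push_inv[OF reduced_foldr_push[OF assms], of a v'] by (simp add: Cons push_def)
  qed (simp add: Cons push_def)
qed (simp add: push_def)

lemma foldr_push_assoc:
  "reduced w \<Longrightarrow> foldr push (foldr push u v) w = foldr push u (foldr push v w)"
  by (induction u) (simp_all add: foldr_push_push)

lemma foldr_push_Nil: "reduced u \<Longrightarrow> foldr push u [] = u"
proof (induction u)
  case (Cons a u)
  then show ?case using push_eq_Cons[of a u] by (simp add: reduced_Cons)
qed simp

lemma foldr_push_inverse:
  "reduced w \<Longrightarrow> foldr push (rev (map letter_inv u)) (foldr push u w) = w"
proof (induction u)
  case (Cons a u)
  then show ?case
    using push_push_inv[OF reduced_foldr_push, of w "letter_inv a" u] by simp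
qed simp

lemma group_free_group: "group (free_group X)"
proof (rule groupI)
  fix u assume u: "u \<in> carrier (free_group X)"
  define v where "v = foldr push (rev (map letter_inv u)) []"
  have r: "reduced u" "fst ` set u \<subseteq> X" using u by (auto simp: free_group_def)
  have "set v \<subseteq> letter_inv ` set u"
    using set_foldr_push[of "rev (map letter_inv u)" "[]"] by (simp add: v_def)
  then have "fst ` set v \<subseteq> fst ` letter_inv ` set u" by (rule image_mono)
  then have "v \<in> carrier (free_group X)"
    using r by (auto simp: free_group_def v_def reduced_foldr_push image_image)
  moreover have "foldr push v u = []"
    unfolding v_def
    using foldr_push_assoc[OF r(1)] foldr_push_inverse[of "[]" u] foldr_push_Nil[OF r(1)] by simp
  ultimately show "\<exists>v\<in>carrier (free_group X). v \<otimes>\<^bsub>free_group X\<^esub> u = \<one>\<^bsub>free_group X\<^esub>"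
    by (auto simp: free_group_def)
next
  fix u v assume "u \<in> carrier (free_group X)" "v \<in> carrier (free_group X)"
  then show "u \<otimes>\<^bsub>free_group X\<^esub> v \<in> carrier (free_group X)"
    using set_foldr_push[of u v] by (auto simp: free_group_def reduced_foldr_push) fastforce
qed (auto simp: free_group_def foldr_push_assoc)


section \<open>Spheres, frequencies, and the measures\<close>

definition sphere_F :: "'a set \<Rightarrow> nat \<Rightarrow> 'a letter list set" where
  "sphere_F X k = {w \<in> carrier (free_group X). length w = k}"

definition freq :: "'a set \<Rightarrow> 'a letter list set \<Rightarrow> nat \<Rightarrow> real" where
  "freq X R k = real (card (R \<inter> sphere_F X k)) / real (card (sphere_F X k))"

text \<open>The atomic measure \<open>\<mu>\<^sub>s\<close> is given by its point masses, with \<open>m = card X\<close>.\<close>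

definition mu :: "'a set \<Rightarrow> real \<Rightarrow> 'a letter list \<Rightarrow> real" where
  "mu X s w = (let m = real (card X) in
     if w = \<one>\<^bsub>free_group X\<^esub> then s
     else s * (1 - s) ^ length w / (2 * m * (2 * m - 1) ^ (length w - 1)))"

definition mu_star :: "'a set \<Rightarrow> 'a letter list set \<Rightarrow> real \<Rightarrow> real" where
  "mu_star X R s = (let m = real (card X) in
     2 * m / (2 * m - 1) * (\<Sum>k. freq X R k * (1 - s) ^ k))"


section \<open>Growth on average\<close>

definition cont_prob_density :: "(real \<Rightarrow> real) \<Rightarrow> bool" where
  "cont_prob_density \<eta> \<longleftrightarrow>
     continuous_on {0<..<1} \<eta> \<and> (\<forall>s\<in>{0<..<1}. 0 \<le> \<eta> s) \<and>
     set_integrable lborel {0<..<1} \<eta> \<and> (LINT s:{0<..<1}|lborel. \<eta> s) = 1"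

text \<open>Since \<open>infsum\<close> is \<open>0\<close> for families that are not summable, finiteness of \<open>M_f\<close> is a separate
  requirement.\<close>

definition mean_finite :: "'a set \<Rightarrow> ('a letter list \<Rightarrow> real) \<Rightarrow> bool" where
  "mean_finite X f \<longleftrightarrow>
     (\<forall>s\<in>{0<..<1}. (\<lambda>w. f w * mu X s w) summable_on carrier (free_group X))"

definition mean :: "'a set \<Rightarrow> ('a letter list \<Rightarrow> real) \<Rightarrow> real \<Rightarrow> real" where
  "mean X f s = (\<Sum>\<^sub>\<infinity>w\<in>carrier (free_group X). f w * mu X s w)"

definition avg_growth_le :: "'a set \<Rightarrow> (real \<Rightarrow> real) \<Rightarrow> nat \<Rightarrow> ('a letter list \<Rightarrow> real) \<Rightarrow> bool" where
  "avg_growth_le X \<eta> d f \<longleftrightarrow>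
     (\<forall>w\<in>carrier (free_group X). 0 \<le> f w) \<and> mean_finite X f \<and>
     (\<exists>\<epsilon>\<in>{0<..<1}. set_integrable lborel {0<..<\<epsilon>} (\<lambda>s. s ^ d * mean X f s * \<eta> s))"

definition poly_negligible :: "'a set \<Rightarrow> (real \<Rightarrow> real) \<Rightarrow> 'a letter list set \<Rightarrow> bool" where
  "poly_negligible X \<eta> R \<longleftrightarrow>
     (\<forall>d::nat. d > 0 \<longrightarrow> avg_growth_le X \<eta> 0 (\<lambda>w. real (length w) ^ d * indicator R w))"


section \<open>Analytic continuation to 0\<close>

text \<open>A function given on \<open>(0,1)\<close> continues analytically to a complex neighbourhood of \<open>0\<close> and is
  regular at \<open>0\<close>: it agrees on the real interval with a function holomorphic on an open set
  containing \<open>0\<close>.\<close>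

definition continues_regularly_to_0 :: "(real \<Rightarrow> real) \<Rightarrow> bool" where
  "continues_regularly_to_0 h \<longleftrightarrow>
     (\<exists>U g. open U \<and> (0::complex) \<in> U \<and> g holomorphic_on U \<and>
            (\<forall>s\<in>{0<..<1}. complex_of_real s \<in> U \<longrightarrow> g (complex_of_real s) = complex_of_real (h s)))"

end

theory Submission
  imports Defs
begin

text \<open>
  Writing \<open>f\<^sub>k\<close> for the frequency of \<open>R\<close> in the sphere of radius \<open>k\<close>, the measure \<open>\<mu>\<^sub>s\<close> gives each
  sphere the mass \<open>s (1 - s)\<^sup>k\<close>, spread evenly over its elements. Hence the mean of
  \<open>|w|\<^sup>d \<chi>(w)\<close> is \<open>s \<Sum>\<^sub>k k\<^sup>d f\<^sub>k (1 - s)\<^sup>k\<close> (lemma \<open>has_sum_mu_radial\<close>). If the single number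
  \<open>C = \<Sum>\<^sub>k k\<^sup>d f\<^sub>k\<close> is finite, then the mean is at most \<open>C\<close> for every \<open>s\<close>, and its product with
  the integrable density \<open>\<eta>\<close> is integrable near \<open>0\<close> (indeed on all of \<open>(0,1)\<close>). So the
  theorem reduces to the finiteness of all moments of the sequence \<open>f\<close>.

  The moments are values at \<open>x = 1\<close> of power series: with \<open>P(x) = \<Sum>\<^sub>k f\<^sub>k x\<^sup>k\<close>, the
  series \<open>\<Sum>\<^sub>k k\<^sup>d f\<^sub>k x\<^sup>k\<close> is obtained from \<open>P\<close> by applying the operator \<open>x d/dx\<close> exactly \<open>d\<close>
  times. The substitution \<open>x = 1 - s\<close> turns regularity of \<open>\<mu>*(R)\<close> at \<open>s = 0\<close> into regularity of
  \<open>P\<close> at \<open>x = 1\<close>, a property that \<open>x d/dx\<close> preserves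
  (lemma \<open>powser_regular_at_1_mult_index\<close>). Finally, a power series with non-negative
  coefficients that stays bounded as \<open>x\<close> tends to \<open>1\<close> from the left converges at \<open>1\<close>
  (lemma \<open>powser_regular_at_1_imp_summable\<close>), and a continuation to \<open>1\<close> gives this bound.
\<close>

section \<open>Power series with non-negative coefficients that are regular at 1\<close>

text \<open>Only the sums on a real interval to the left of \<open>1\<close> are prescribed; since such an interval
  reaches up to \<open>1\<close>, this already forces convergence on the whole open unit disc.\<close>

definition powser_regular_at_1 :: "(nat \<Rightarrow> real) \<Rightarrow> bool" where
  "powser_regular_at_1 a \<longleftrightarrow>
     (\<exists>G r. 0 < r \<and> r \<le> 1 \<and> G holomorphic_on ball 1 r \<and>
            (\<forall>x\<in>{1-r<..<1}. (\<lambda>k. a k * x ^ k) sums Re (G (complex_of_real x))))"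

text \<open>The partial sums of \<open>\<Sum>\<^sub>k a\<^sub>k x\<^sup>k\<close> lie below the value of the continuation at \<open>x\<close>; letting \<open>x\<close>
  tend to \<open>1\<close>, the partial sums of \<open>\<Sum>\<^sub>k a\<^sub>k\<close> lie below its value at \<open>1\<close>.\<close>

lemma powser_regular_at_1_imp_summable:
  assumes nonneg: "\<And>k. 0 \<le> a k" and "powser_regular_at_1 a"
  shows "summable a"
proof -
  obtain G r where r: "0 < r" "r \<le> 1" and G: "G holomorphic_on ball 1 r"
    and sums: "\<And>x. x \<in> {1-r<..<1} \<Longrightarrow> (\<lambda>k. a k * x ^ k) sums Re (G (complex_of_real x))"
    using assms(2) unfolding powser_regular_at_1_def by blast
  have "isCont G (complex_of_real 1)"
    using holomorphic_on_imp_continuous_on[OF G] r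
    by (simp add: continuous_on_eq_continuous_at)
  then have "isCont (\<lambda>x. Re (G (complex_of_real x))) 1"
    by (intro isCont_Re isCont_o2[of 1 complex_of_real G]) simp_all
  then have lim_G: "((\<lambda>x. Re (G (complex_of_real x))) \<longlongrightarrow> Re (G 1)) (at_left 1)"
    by (simp add: isCont_def filterlim_at_split)
  have "(\<Sum>k<n. a k) \<le> Re (G 1)" for n
  proof (rule tendsto_le[OF _ lim_G])
    have "((\<lambda>x. \<Sum>k<n. a k * x ^ k) \<longlongrightarrow> (\<Sum>k<n. a k * 1 ^ k)) (at_left 1)"
      by (intro tendsto_intros)
    then show "((\<lambda>x. \<Sum>k<n. a k * x ^ k) \<longlongrightarrow> (\<Sum>k<n. a k)) (at_left 1)"
      by simp
    have "\<forall>\<^sub>F x in at_left 1. x \<in> {1-r<..<1}"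
      using r by (intro eventually_at_left_real) auto
    then show "\<forall>\<^sub>F x in at_left 1. (\<Sum>k<n. a k * x ^ k) \<le> Re (G (complex_of_real x))"
    proof eventually_elim
      case (elim x)
      have "(\<Sum>k<n. a k * x ^ k) \<le> (\<Sum>k. a k * x ^ k)"
        using sums[OF elim] elim r nonneg by (intro sum_le_suminf) (auto simp: sums_iff)
      then show ?case
        using sums[OF elim] by (simp add: sums_iff)
    qed
  qed simp
  then show ?thesis
    by (rule summableI_nonneg_bounded[OF nonneg])
qed

text \<open>The new coefficients are those of \<open>x P'(x)\<close> if the old ones are those of \<open>P(x)\<close>, so
  \<open>z G'(z)\<close> continues the new series if \<open>G\<close> continues the old one.\<close>

lemma powser_regular_at_1_mult_index:
  assumes "powser_regular_at_1 a"
  shows "powser_regular_at_1 (\<lambda>k. real k * a k)"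
proof -
  obtain G r where r: "0 < r" "r \<le> 1" and G: "G holomorphic_on ball 1 r"
    and sums: "\<And>x. x \<in> {1-r<..<1} \<Longrightarrow> (\<lambda>k. a k * x ^ k) sums Re (G (complex_of_real x))"
    using assms unfolding powser_regular_at_1_def by blast
  let ?G' = "\<lambda>z. z * deriv G z"
  have "?G' holomorphic_on ball 1 r"
    using G by (intro holomorphic_intros) auto
  moreover have "(\<lambda>k. real k * a k * x ^ k) sums Re (?G' (complex_of_real x))"
    if x: "x \<in> {1-r<..<1}" for x
  proof -
    obtain y where y: "x < y" "y < 1"
      using x dense[of x 1] by auto
    have y_sum: "summable (\<lambda>k. a k * y ^ k)"
      using sums[of y] x y r by (auto simp: sums_iff)
    have x_lt: "norm x < norm y"
      using x y r by auto
    have P': "((\<lambda>x. \<Sum>k. a k * x ^ k) has_real_derivative (\<Sum>k. diffs a k * x ^ k)) (at x)"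
      by (rule termdiffs_strong[OF y_sum x_lt])
    have "complex_of_real x \<in> ball 1 r"
      using x r dist_of_real[of 1 x, where 'a = complex] by (simp add: dist_real_def)
    then have "(G has_field_derivative deriv G (complex_of_real x)) (at (complex_of_real x))"
      using G by (intro holomorphic_derivI) auto
    then have "((\<lambda>x. Re (G (complex_of_real x))) has_real_derivative
                 Re (deriv G (complex_of_real x))) (at x)"
      by (intro has_field_derivative_Re has_vector_derivative_real_field)
    then have "((\<lambda>x. \<Sum>k. a k * x ^ k) has_real_derivative
                 Re (deriv G (complex_of_real x))) (at x)"
      by (rule has_field_derivative_transform_within_open[where S = "{1-r<..<1}"])
        (use x sums in \<open>auto simp: sums_iff\<close>)
    with P' have eq: "(\<Sum>k. diffs a k * x ^ k) = Re (deriv G (complex_of_real x))"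
      by (rule DERIV_unique)
    have "summable (\<lambda>k. diffs a k * x ^ k)"
    proof (rule termdiff_converges[of x y])
      show "summable (\<lambda>k. a k * z ^ k)" if "norm z < y" for z
        using powser_inside[OF y_sum, of z] that by simp
    qed (use x_lt x y r in auto)
    then have "(\<lambda>k. real k * a k * x ^ (k - Suc 0)) sums Re (deriv G (complex_of_real x))"
      using diffs_equiv[of a x] eq by simp
    then have "(\<lambda>k. x * (real k * a k * x ^ (k - Suc 0)))
                 sums (x * Re (deriv G (complex_of_real x)))"
      by (rule sums_mult)
    moreover have "x * (real k * a k * x ^ (k - Suc 0)) = real k * a k * x ^ k" for k
      by (cases k) auto
    ultimately show ?thesis
      by simp
  qed
  ultimately show ?thesis
    using r unfolding powser_regular_at_1_def by blast
qed

lemma powser_regular_at_1_moments: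
  assumes "powser_regular_at_1 a"
  shows "powser_regular_at_1 (\<lambda>k. real k ^ d * a k)"
proof (induction d)
  case (Suc d)
  then show ?case
    using powser_regular_at_1_mult_index[OF Suc] by (simp add: mult.assoc)
qed (use assms in simp)

section \<open>Spheres in the free group and their masses\<close>

lemma finite_sphere_F:
  assumes "finite X"
  shows "finite (sphere_F X k)"
proof (rule finite_subset)
  show "sphere_F X k \<subseteq> {w. set w \<subseteq> X \<times> UNIV \<and> length w = k}"
    by (auto simp: sphere_F_def free_group_def)
  show "finite {w. set w \<subseteq> X \<times> (UNIV :: bool set) \<and> length w = k}"
    using assms by (intro finite_lists_length_eq) auto
qed

lemma sphere_F_0: "sphere_F X 0 = {[]}"
  by (auto simp: sphere_F_def free_group_def)

text \<open>A non-empty reduced word of length \<open>k\<close> can be extended on the left by every letter except the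
  inverse of its first one, which gives the factor \<open>2m - 1\<close>.\<close>

lemma card_sphere_F_Suc:
  assumes "finite X" "X \<noteq> {}"
  shows "card (sphere_F X (Suc k)) = 2 * card X * (2 * card X - 1) ^ k"
proof (induction k)
  case 0
  have "sphere_F X (Suc 0) = (\<lambda>a. [a]) ` (X \<times> UNIV)"
    by (fastforce simp: sphere_F_def free_group_def length_Suc_conv reduced_Cons)
  moreover have "card ((\<lambda>a. [a]) ` (X \<times> (UNIV :: bool set))) = card (X \<times> (UNIV :: bool set))"
    by (intro card_image) (auto simp: inj_on_def)
  ultimately show ?case
    by (simp add: card_cartesian_product)
next
  case (Suc k)
  let ?B = "\<lambda>w. X \<times> UNIV - {letter_inv (hd w)}"
  have "bij_betw (\<lambda>(w, a). a # w) (Sigma (sphere_F X (Suc k)) ?B) (sphere_F X (Suc (Suc k)))"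
  proof (rule bij_betwI[where g = "\<lambda>w. (tl w, hd w)"])
    show "(\<lambda>(w, a). a # w) \<in> Sigma (sphere_F X (Suc k)) ?B \<rightarrow> sphere_F X (Suc (Suc k))"
      by (auto simp: sphere_F_def free_group_def reduced_Cons image_subset_iff)
    show "(\<lambda>w. (tl w, hd w)) \<in> sphere_F X (Suc (Suc k)) \<rightarrow> Sigma (sphere_F X (Suc k)) ?B"
      by (auto simp: sphere_F_def free_group_def reduced_Cons length_Suc_conv mem_Times_iff
               image_subset_iff)
  qed (auto simp: sphere_F_def length_Suc_conv)
  then have "card (sphere_F X (Suc (Suc k))) = card (Sigma (sphere_F X (Suc k)) ?B)"
    by (metis bij_betw_same_card)
  also have "\<dots> = (\<Sum>w\<in>sphere_F X (Suc k). card (?B w))"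
    using assms finite_sphere_F by (intro card_SigmaI) auto
  also have "\<dots> = (\<Sum>w\<in>sphere_F X (Suc k). 2 * card X - 1)"
  proof (rule sum.cong)
    fix w assume "w \<in> sphere_F X (Suc k)"
    then have "letter_inv (hd w) \<in> X \<times> UNIV"
      by (auto simp: sphere_F_def free_group_def length_Suc_conv mem_Times_iff)
    then show "card (?B w) = 2 * card X - 1"
      using assms by (simp add: card_Diff_singleton card_cartesian_product mult.commute)
  qed simp
  also have "\<dots> = 2 * card X * (2 * card X - 1) ^ Suc k"
    by (simp add: Suc.IH)
  finally show ?case .
qed

lemma card_sphere_F_pos:
  assumes "finite X" "X \<noteq> {}"
  shows "0 < card (sphere_F X k)"
  using assms card_gt_0_iff[of X]
  by (cases k) (auto simp: sphere_F_0 card_sphere_F_Suc)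

text \<open>The two cases in the definition of the measure are one: every sphere carries a uniform
  distribution scaled by the geometric weight of its radius.\<close>

lemma mu_on_sphere_F:
  assumes "finite X" "X \<noteq> {}" and w: "w \<in> sphere_F X k"
  shows "mu X s w = s * (1 - s) ^ k / real (card (sphere_F X k))"
proof (cases k)
  case 0
  then show ?thesis
    using w by (simp add: sphere_F_0 mu_def free_group_def)
next
  case (Suc j)
  have "real (2 * card X - 1) = 2 * real (card X) - 1"
    using assms card_gt_0_iff[of X] by (simp add: of_nat_diff)
  then have "real (card (sphere_F X k)) = 2 * real (card X) * (2 * real (card X) - 1) ^ j"
    by (simp add: Suc card_sphere_F_Suc[OF assms(1,2)])
  moreover have "length w = Suc j" "w \<noteq> []"
    using w Suc by (auto simp: sphere_F_def)
  ultimately show ?thesis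
    by (simp add: mu_def free_group_def Suc Let_def)
qed

lemma freq_nonneg: "0 \<le> freq X R k"
  by (simp add: freq_def)

lemma freq_le_1:
  assumes "finite X"
  shows "freq X R k \<le> 1"
proof -
  have "card (R \<inter> sphere_F X k) \<le> card (sphere_F X k)"
    using assms by (intro card_mono finite_sphere_F) auto
  then show ?thesis
    by (simp add: freq_def divide_le_eq_1 flip: neq0_conv)
qed

text \<open>The group is the disjoint union of its spheres, and a function of the length is constant on
  each of them, so that its sum over \<open>R\<close> only sees the frequencies.\<close>

lemma has_sum_mu_radial:
  assumes X: "finite X" "X \<noteq> {}" and s: "s \<in> {0<..<1}"
    and nonneg: "\<And>k. 0 \<le> c k"
    and summable: "summable (\<lambda>k. c k * freq X R k * (1 - s) ^ k)"
  shows "((\<lambda>w. c (length w) * indicator R w * mu X s w) has_sum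
            (s * (\<Sum>k. c k * freq X R k * (1 - s) ^ k))) (carrier (free_group X))"
proof -
  let ?f = "\<lambda>w. c (length w) * indicator R w * mu X s w"
  let ?g = "\<lambda>k. s * (c k * freq X R k * (1 - s) ^ k)"
  have sphere: "((\<lambda>w. ?f w) has_sum ?g k) (sphere_F X k)" for k
  proof -
    have "(\<Sum>w\<in>sphere_F X k. ?f w) =
          (\<Sum>w\<in>sphere_F X k. indicator R w * (c k * (s * (1 - s) ^ k / card (sphere_F X k))))"
      by (rule sum.cong) (auto simp: mu_on_sphere_F[OF X] sphere_F_def)
    also have "\<dots> = real (card (R \<inter> sphere_F X k)) *
                     (c k * (s * (1 - s) ^ k / card (sphere_F X k)))"
    proof -
      have "(\<Sum>w\<in>sphere_F X k. indicator R w) = real (card (R \<inter> sphere_F X k))"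
        using X sum.inter_restrict[of "sphere_F X k" "\<lambda>_. 1::real" R] finite_sphere_F[of X k]
        by (simp add: indicator_def of_bool_def Int_commute)
      then show ?thesis
        by (simp only: sum_distrib_right[symmetric])
    qed
    also have "\<dots> = ?g k"
      by (simp add: freq_def)
    finally show ?thesis
      using has_sum_finite[OF finite_sphere_F[OF X(1)], of ?f k] by simp
  qed
  have g: "(?g has_sum (s * (\<Sum>k. c k * freq X R k * (1 - s) ^ k))) UNIV"
    using s nonneg freq_nonneg summable
    by (intro sums_nonneg_imp_has_sum sums_mult summable_sums mult_nonneg_nonneg) auto
  have f_nonneg: "0 \<le> ?f w" if "w \<in> sphere_F X k" for w k
    using s nonneg by (auto simp: mu_on_sphere_F[OF X that])
  let ?S = "Sigma UNIV (sphere_F X)"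
  have "(\<lambda>(k, w). ?f w) summable_on ?S"
    using sphere g f_nonneg
    by (intro summable_on_SigmaI[where g = ?g]) (auto simp: summable_on_def)
  then have "((\<lambda>(k, w). ?f w) has_sum (s * (\<Sum>k. c k * freq X R k * (1 - s) ^ k))) ?S"
    using sphere g by (intro has_sum_SigmaI[where g = ?g]) auto
  moreover have "bij_betw snd ?S (carrier (free_group X))"
    by (rule bij_betwI[where g = "\<lambda>w. (length w, w)"]) (auto simp: sphere_F_def)
  ultimately show ?thesis
    using has_sum_reindex_bij_betw[of snd ?S _ ?f] by (simp add: case_prod_unfold)
qed

section \<open>From regularity to negligibility\<close>

text \<open>The continuation at \<open>s = 0\<close> is transported to \<open>x = 1\<close> by \<open>x = 1 - s\<close>, and the constant
  \<open>2m/(2m-1)\<close> is divided out.\<close>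

lemma powser_regular_at_1_freq:
  assumes X: "finite X" "X \<noteq> {}" and "continues_regularly_to_0 (mu_star X R)"
  shows "powser_regular_at_1 (freq X R)"
proof -
  obtain U g where U: "open U" "0 \<in> U" and g: "g holomorphic_on U"
    and g_eq: "\<And>s. s \<in> {0<..<1} \<Longrightarrow> complex_of_real s \<in> U \<Longrightarrow>
                 g (complex_of_real s) = complex_of_real (mu_star X R s)"
    using assms(3) unfolding continues_regularly_to_0_def by blast
  obtain e where e: "0 < e" "ball 0 e \<subseteq> U"
    using U by (meson open_contains_ball)
  define r where "r = min e 1"
  define m where "m = real (card X)"
  define G where "G z = complex_of_real ((2 * m - 1) / (2 * m)) * g (1 - z)" for z
  have r: "0 < r" "r \<le> 1" "r \<le> e"
    using e by (auto simp: r_def)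
  have m: "1 \<le> m"
    using X card_gt_0_iff[of X] by (simp add: m_def Suc_le_eq)
  have "(\<lambda>z. g (1 - z)) holomorphic_on ball 1 r"
  proof (rule holomorphic_on_compose_gen[where g = g and f = "\<lambda>z. 1 - z", unfolded o_def])
    show "(\<lambda>z. 1 - z) ` ball 1 r \<subseteq> U"
    proof (rule order_trans[OF _ e(2)], safe)
      fix z :: complex assume "z \<in> ball 1 r"
      then show "1 - z \<in> ball 0 e"
        using r by (simp add: dist_norm norm_minus_commute)
    qed
  qed (use g in \<open>auto intro!: holomorphic_intros\<close>)
  then have "G holomorphic_on ball 1 r"
    unfolding G_def by (intro holomorphic_intros)
  moreover have "(\<lambda>k. freq X R k * x ^ k) sums Re (G (complex_of_real x))"
    if x: "x \<in> {1-r<..<1}" for x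
  proof -
    have "complex_of_real (1 - x) \<in> U"
      using x e(2) r by (auto simp del: of_real_diff)
    then have "g (1 - complex_of_real x) = complex_of_real (mu_star X R (1 - x))"
      using g_eq[of "1 - x"] x r by simp
    then have "Re (G (complex_of_real x)) = (2 * m - 1) / (2 * m) * mu_star X R (1 - x)"
      by (simp add: G_def flip: of_real_mult of_real_divide)
    also have "\<dots> = (\<Sum>k. freq X R k * x ^ k)"
      using m by (simp add: mu_star_def Let_def m_def[symmetric])
    finally have "Re (G (complex_of_real x)) = (\<Sum>k. freq X R k * x ^ k)" .
    moreover have "summable (\<lambda>k. freq X R k * x ^ k)"
    proof (rule summable_comparison_test')
      show "summable (\<lambda>k. x ^ k)"
        using x r by (intro summable_geometric) auto
      show "norm (freq X R k * x ^ k) \<le> x ^ k" for k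
        using x r freq_nonneg[of X R k] freq_le_1[OF X(1), of R k]
        by (simp add: abs_mult mult_left_le_one_le)
    qed
    ultimately show ?thesis
      by (simp add: sums_iff)
  qed
  ultimately show ?thesis
    using r unfolding powser_regular_at_1_def by blast
qed

text \<open>Finiteness of one weighted total frequency bounds the mean uniformly in \<open>s\<close>, so that the
  density itself is, up to a constant, an integrable majorant.\<close>

lemma avg_growth_le_0_if_summable:
  assumes X: "finite X" "X \<noteq> {}" and \<eta>: "cont_prob_density \<eta>"
    and nonneg: "\<And>k. 0 \<le> c k" and summable: "summable (\<lambda>k. c k * freq X R k)"
  shows "avg_growth_le X \<eta> 0 (\<lambda>w. c (length w) * indicator R w)"
proof -
  let ?f = "\<lambda>w. c (length w) * indicator R w"
  define a where "a k = c k * freq X R k" for k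
  have a_nonneg: "0 \<le> a k" for k
    by (simp add: a_def nonneg freq_nonneg)
  have term_le: "a k * (1 - s) ^ k \<le> a k" if "s \<in> {0<..<1}" for s k
    using that a_nonneg by (intro mult_left_le power_le_one) auto
  have series: "summable (\<lambda>k. a k * (1 - s) ^ k)" if "s \<in> {0<..<1}" for s
  proof (rule summable_comparison_test')
    show "summable a"
      using summable by (simp add: a_def [abs_def])
    show "norm (a k * (1 - s) ^ k) \<le> a k" for k
      using term_le[OF that] that a_nonneg by (simp add: abs_mult)
  qed
  have sum: "((\<lambda>w. ?f w * mu X s w) has_sum (s * (\<Sum>k. a k * (1 - s) ^ k)))
               (carrier (free_group X))" if "s \<in> {0<..<1}" for s
    using has_sum_mu_radial[OF X that, where c = c and R = R] nonneg series[OF that] by (simp add: a_def)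
  have mean_eq: "mean X ?f s = s * (\<Sum>k. a k * (1 - s) ^ k)" if "s \<in> {0<..<1}" for s
    unfolding mean_def using sum[OF that] by (rule infsumI)
  have mean_bound: "norm (mean X ?f s) \<le> (\<Sum>k. a k)" if s: "s \<in> {0<..<1}" for s
  proof -
    have "0 \<le> (\<Sum>k. a k * (1 - s) ^ k)"
      using s a_nonneg series by (intro suminf_nonneg) auto
    moreover have "(\<Sum>k. a k * (1 - s) ^ k) \<le> (\<Sum>k. a k)"
      using term_le series s summable by (intro suminf_le) (auto simp: a_def [abs_def])
    ultimately show ?thesis
      using s mult_left_le_one_le[of "\<Sum>k. a k * (1 - s) ^ k" s] by (simp add: mean_eq abs_mult)
  qed
  have \<eta>_int: "set_integrable lborel {0<..<1/2} \<eta>"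
    using \<eta> by (auto simp: cont_prob_density_def intro: set_integrable_subset)
  have "set_integrable lborel {0<..<1/2} (\<lambda>s. s ^ 0 * mean X ?f s * \<eta> s)"
  proof (rule set_integrable_bound)
    show "set_integrable lborel {0<..<1/2} (\<lambda>s. (\<Sum>k. a k) * \<eta> s)"
      using \<eta>_int by simp
    have [measurable]: "(\<lambda>s. indicator {0<..<1/2} s *\<^sub>R \<eta> s) \<in> borel_measurable lborel"
      using \<eta>_int unfolding set_integrable_def by (rule borel_measurable_integrable)
    have "(\<lambda>s. (s * (\<Sum>k. a k * (1 - s) ^ k)) * (indicator {0<..<1/2} s *\<^sub>R \<eta> s))
            \<in> borel_measurable lborel"
      by measurable
    also have "(\<lambda>s. (s * (\<Sum>k. a k * (1 - s) ^ k)) * (indicator {0<..<1/2} s *\<^sub>R \<eta> s)) =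
               (\<lambda>s. indicator {0<..<1/2} s *\<^sub>R (s ^ 0 * mean X ?f s * \<eta> s))"
      by (rule ext) (simp add: mean_eq split: split_indicator)
    finally show "set_borel_measurable lborel {0<..<1/2} (\<lambda>s. s ^ 0 * mean X ?f s * \<eta> s)"
      unfolding set_borel_measurable_def .
    show "AE s in lborel. s \<in> {0<..<1/2} \<longrightarrow>
            norm (s ^ 0 * mean X ?f s * \<eta> s) \<le> norm ((\<Sum>k. a k) * \<eta> s)"
    proof (intro AE_I2 impI)
      fix s :: real assume "s \<in> {0<..<1/2}"
      then have "norm (mean X ?f s) \<le> norm (\<Sum>k. a k)"
        using mean_bound[of s] by force
      then show "norm (s ^ 0 * mean X ?f s * \<eta> s) \<le> norm ((\<Sum>k. a k) * \<eta> s)"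
        by (simp add: abs_mult mult_right_mono)
    qed
  qed
  moreover have "mean_finite X ?f"
    using sum unfolding mean_finite_def summable_on_def by blast
  ultimately show ?thesis
    using nonneg unfolding avg_growth_le_def by (intro conjI bexI[of _ "1/2"]) auto
qed

theorem theorem1p5:
  fixes X :: "'a set" and R :: "'a letter list set" and \<eta> :: "real \<Rightarrow> real"
  assumes "finite X" and "X \<noteq> {}"
    and "R \<subseteq> carrier (free_group X)"
    and "cont_prob_density \<eta>"
    and "continues_regularly_to_0 (mu_star X R)"
  shows "poly_negligible X \<eta> R"
  unfolding poly_negligible_def
proof (intro allI impI)
  fix d :: nat
  have "powser_regular_at_1 (\<lambda>k. real k ^ d * freq X R k)"
    using assms by (intro powser_regular_at_1_moments powser_regular_at_1_freq)
  then have "summable (\<lambda>k. real k ^ d * freq X R k)"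
    by (intro powser_regular_at_1_imp_summable) (auto simp: freq_nonneg)
  then show "avg_growth_le X \<eta> 0 (\<lambda>w. real (length w) ^ d * indicator R w)"
    using assms avg_growth_le_0_if_summable[of X \<eta> "\<lambda>k. real k ^ d"] by simp
qed

end
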